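(* Let $$G=\langle a,b\mid a^7=b^3=e,\ bab^{-1}=a^2\rangle$$ and let $S=\partial\{e,a,b\}$. Then $$i\bigl(\operatorname{Cay}(G,S)\bigr)=3\qquad\text{and}\qquad \alpha\bigl(\operatorname{Cay}(G,S)\bigr)=6 .$$
   Context: For a non-empty subset $A$ of a group $G$ with identity $e$, $\partial A=A^{-1}A\setminus\{e\}$, where $A^{-1}A=\{x^{-1}y\mid x,y\in A\}$. For a subset $S\subseteq G$ with $e\notin S$ and $S=S^{-1}$, the (left) Cayley graph $\operatorname{Cay}(G,S)$ is the simple graph with vertex set $G$ in which $u,v$ are adjacent if and only if $vu^{-1}\in S$. For a finite graph $\Gamma$, $\alpha(\Gamma)$ is the size of a largest independent set and $i(\Gamma)$ is the size of a smallest maximal (with respect to inclusion) independent set. *)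

theory Defs
  imports "HOL-Algebra.Group"
begin

section \<open>Group presentations\<close>

datatype 'g letter = Pos 'g | Neg 'g

text \<open>
  The congruence on words over the letters \<open>x\<close>, \<open>x\<inverse>\<close> (for \<open>x :: 'g\<close>) that is generated by free
  cancellation and a set \<open>R\<close> of relations; a pair \<open>(u, v) \<in> R\<close> stands for the relation \<open>u = v\<close>.
\<close>

inductive word_eq :: "('g letter list \<times> 'g letter list) set \<Rightarrow> 'g letter list \<Rightarrow> 'g letter list \<Rightarrow> bool"
  for R where
  rel: "(u, v) \<in> R \<Longrightarrow> word_eq R u v"
| cancel_right: "word_eq R [Pos x, Neg x] []"
| cancel_left: "word_eq R [Neg x, Pos x] []"
| refl: "word_eq R w w"
| sym: "word_eq R u v \<Longrightarrow> word_eq R v u"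
| trans: "word_eq R u v \<Longrightarrow> word_eq R v w \<Longrightarrow> word_eq R u w"
| append: "word_eq R u u' \<Longrightarrow> word_eq R v v' \<Longrightarrow> word_eq R (u @ v) (u' @ v')"

definition word_class :: "('g letter list \<times> 'g letter list) set \<Rightarrow> 'g letter list \<Rightarrow> 'g letter list set" where
  "word_class R w = {v. word_eq R w v}"

text \<open>
  The group with generating set \<open>UNIV :: 'g set\<close> and defining relations \<open>R\<close>.
\<close>

definition presented_group :: "('g letter list \<times> 'g letter list) set \<Rightarrow> 'g letter list set monoid" where
  "presented_group R =
    \<lparr>carrier = range (word_class R),
     mult = (\<lambda>X Y. \<Union>u\<in>X. \<Union>v\<in>Y. word_class R (u @ v)),
     one = word_class R []\<rparr>"

definition presented_gen :: "('g letter list \<times> 'g letter list) set \<Rightarrow> 'g \<Rightarrow> 'g letter list set" where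
  "presented_gen R x = word_class R [Pos x]"

lemma word_class_eq_iff: "word_class R u = word_class R v \<longleftrightarrow> word_eq R u v"
proof
  assume "word_class R u = word_class R v"
  moreover have "v \<in> word_class R v"
    by (simp add: word_class_def word_eq.refl)
  ultimately have "v \<in> word_class R u"
    by simp
  then show "word_eq R u v"
    by (simp add: word_class_def)
next
  assume uv: "word_eq R u v"
  have "word_eq R u w \<longleftrightarrow> word_eq R v w" for w
    using word_eq.trans[OF uv] word_eq.trans[OF word_eq.sym[OF uv]] by blast
  then show "word_class R u = word_class R v"
    by (simp add: word_class_def)
qed

lemma word_class_self: "w \<in> word_class R w"
  by (simp add: word_class_def word_eq.refl)

lemma carrier_presented_group: "carrier (presented_group R) = range (word_class R)"
  by (simp add: presented_group_def)

lemma one_presented_group: "\<one>\<^bsub>presented_group R\<^esub> = word_class R []"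
  by (simp add: presented_group_def)

lemma mult_presented_group:
  "word_class R u \<otimes>\<^bsub>presented_group R\<^esub> word_class R v = word_class R (u @ v)"
proof -
  have "word_class R (u' @ v') = word_class R (u @ v)"
    if "u' \<in> word_class R u" "v' \<in> word_class R v" for u' v'
    using word_eq.sym[OF word_eq.append, of R u u' v v'] that
    by (simp add: word_class_eq_iff) (simp add: word_class_def)
  then have "(\<Union>u'\<in>word_class R u. \<Union>v'\<in>word_class R v. word_class R (u' @ v')) = word_class R (u @ v)"
    using word_class_self[of u R] word_class_self[of v R] by blast
  then show ?thesis
    by (simp add: presented_group_def)
qed

fun letter_inv :: "'g letter \<Rightarrow> 'g letter" where
  "letter_inv (Pos x) = Neg x"
| "letter_inv (Neg x) = Pos x"

lemma word_eq_left_inverse: "word_eq R (rev (map letter_inv w) @ w) []"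
proof (induction w)
  case Nil
  show ?case by (simp add: word_eq.refl)
next
  case (Cons l w)
  let ?w = "rev (map letter_inv w)"
  have "word_eq R [letter_inv l, l] []"
    by (cases l) (simp_all add: word_eq.cancel_left word_eq.cancel_right)
  then have "word_eq R ([letter_inv l, l] @ w) ([] @ w)"
    by (rule word_eq.append[OF _ word_eq.refl])
  then have "word_eq R (?w @ [letter_inv l, l] @ w) (?w @ [] @ w)"
    by (rule word_eq.append[OF word_eq.refl])
  then show ?case
    using word_eq.trans[OF _ Cons.IH] by simp
qed

lemma group_presented_group: "group (presented_group R)"
proof (rule groupI)
  fix X assume "X \<in> carrier (presented_group R)"
  then obtain w where "X = word_class R w"
    by (auto simp: carrier_presented_group)
  then have "word_class R (rev (map letter_inv w)) \<otimes>\<^bsub>presented_group R\<^esub> X = \<one>\<^bsub>presented_group R\<^esub>"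
    by (simp add: mult_presented_group one_presented_group word_class_eq_iff word_eq_left_inverse)
  then show "\<exists>Y\<in>carrier (presented_group R). Y \<otimes>\<^bsub>presented_group R\<^esub> X = \<one>\<^bsub>presented_group R\<^esub>"
    by (auto simp: carrier_presented_group)
qed (auto simp add: carrier_presented_group one_presented_group mult_presented_group)

text \<open>The universal property (von Dyck): \<open>letter_val\<close> evaluates words in a group \<open>H\<close>.\<close>

fun letter_val :: "('h, 'm) monoid_scheme \<Rightarrow> ('g \<Rightarrow> 'h) \<Rightarrow> 'g letter \<Rightarrow> 'h" where
  "letter_val H f (Pos x) = f x"
| "letter_val H f (Neg x) = inv\<^bsub>H\<^esub> f x"

definition word_val :: "('h, 'm) monoid_scheme \<Rightarrow> ('g \<Rightarrow> 'h) \<Rightarrow> 'g letter list \<Rightarrow> 'h" where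
  "word_val H f w = foldr (\<lambda>l y. letter_val H f l \<otimes>\<^bsub>H\<^esub> y) w \<one>\<^bsub>H\<^esub>"

lemma presented_group_universal:
  assumes "group H" and f: "\<And>x. f x \<in> carrier H"
    and R: "\<And>u v. (u, v) \<in> R \<Longrightarrow> word_val H f u = word_val H f v"
  shows "\<exists>h \<in> hom (presented_group R) H. \<forall>x. h (presented_gen R x) = f x"
proof -
  interpret H: group H by fact
  have lc: "letter_val H f l \<in> carrier H" for l
    using f by (cases l) auto
  have wc: "word_val H f w \<in> carrier H" for w
    by (induction w) (auto simp: word_val_def lc)
  have app: "word_val H f (u @ v) = word_val H f u \<otimes>\<^bsub>H\<^esub> word_val H f v" for u v
  proof (induction u)
    case Nil
    then show ?case using wc by (simp add: word_val_def)
  next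
    case (Cons l u)
    then show ?case
      using wc[of u] wc[of v] lc by (simp add: word_val_def H.m_assoc)
  qed
  have eq: "word_val H f u = word_val H f v" if "word_eq R u v" for u v
    using that
  proof induction
    case (cancel_right x)
    then show ?case using f by (simp add: word_val_def)
  next
    case (cancel_left x)
    then show ?case using f by (simp add: word_val_def)
  qed (auto simp: R app)
  define h where "h X = word_val H f (SOME w. w \<in> X)" for X
  have h: "h (word_class R w) = word_val H f w" for w
  proof -
    have "(SOME v. v \<in> word_class R w) \<in> word_class R w"
      using word_class_self by (rule someI)
    then show ?thesis
      unfolding h_def word_class_def mem_Collect_eq by (rule eq[symmetric])
  qed
  have "h \<in> hom (presented_group R) H"
    by (auto simp: hom_def carrier_presented_group mult_presented_group h wc app)
  moreover have "h (presented_gen R x) = f x" for x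
    using f by (simp add: presented_gen_def h word_val_def)
  ultimately show ?thesis by blast
qed


section \<open>Cayley graphs and independent sets\<close>

text \<open>A simple graph is a pair of a vertex set and a set of two-element edges.\<close>

type_synonym 'v simple_graph = "'v set \<times> 'v set set"

definition boundary :: "('a, 'm) monoid_scheme \<Rightarrow> 'a set \<Rightarrow> 'a set" where
  "boundary G A = {inv\<^bsub>G\<^esub> x \<otimes>\<^bsub>G\<^esub> y |x y. x \<in> A \<and> y \<in> A} - {\<one>\<^bsub>G\<^esub>}"

text \<open>
  Left Cayley graph. The edge set is only meaningful for \<open>S\<close> closed under inverses and not
  containing the identity, which always holds for a \<open>boundary\<close> (shown below).
\<close>

definition cayley_graph :: "('a, 'm) monoid_scheme \<Rightarrow> 'a set \<Rightarrow> 'a simple_graph" where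
  "cayley_graph G S =
    (carrier G,
     {{u, v} |u v. u \<in> carrier G \<and> v \<in> carrier G \<and> v \<otimes>\<^bsub>G\<^esub> inv\<^bsub>G\<^esub> u \<in> S})"

definition independent_set :: "'v simple_graph \<Rightarrow> 'v set \<Rightarrow> bool" where
  "independent_set \<Gamma> I \<longleftrightarrow> I \<subseteq> fst \<Gamma> \<and> (\<forall>u\<in>I. \<forall>v\<in>I. {u, v} \<notin> snd \<Gamma>)"

definition maximal_independent_set :: "'v simple_graph \<Rightarrow> 'v set \<Rightarrow> bool" where
  "maximal_independent_set \<Gamma> I \<longleftrightarrow>
    independent_set \<Gamma> I \<and> (\<forall>J. independent_set \<Gamma> J \<and> I \<subseteq> J \<longrightarrow> J = I)"

text \<open>The following two numbers are only meaningful for graphs with finitely many vertices.\<close>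

definition independence_number :: "'v simple_graph \<Rightarrow> nat" where
  "independence_number \<Gamma> = Max (card ` {I. independent_set \<Gamma> I})"

definition independent_domination_number :: "'v simple_graph \<Rightarrow> nat" where
  "independent_domination_number \<Gamma> = Min (card ` {I. maximal_independent_set \<Gamma> I})"

lemma one_notin_boundary: "\<one>\<^bsub>G\<^esub> \<notin> boundary G A"
  by (simp add: boundary_def)

lemma inv_boundary:
  assumes "group G" "A \<subseteq> carrier G"
  shows "(\<lambda>x. inv\<^bsub>G\<^esub> x) ` boundary G A = boundary G A"
proof -
  interpret group G by fact
  have sub: "boundary G A \<subseteq> carrier G"
    using assms(2) by (auto simp: boundary_def)
  have closed: "inv\<^bsub>G\<^esub> s \<in> boundary G A" if "s \<in> boundary G A" for s
  proof -
    from that obtain x y where xy: "x \<in> A" "y \<in> A" "s = inv\<^bsub>G\<^esub> x \<otimes>\<^bsub>G\<^esub> y" "s \<noteq> \<one>\<^bsub>G\<^esub>"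
      by (auto simp: boundary_def)
    have c: "x \<in> carrier G" "y \<in> carrier G" using xy assms(2) by auto
    have "inv\<^bsub>G\<^esub> s = inv\<^bsub>G\<^esub> y \<otimes>\<^bsub>G\<^esub> x"
      using c xy(3) by (simp add: inv_mult_group)
    moreover have "inv\<^bsub>G\<^esub> s \<noteq> \<one>\<^bsub>G\<^esub>"
      using xy(4) sub that by auto
    ultimately show ?thesis using xy by (auto simp: boundary_def)
  qed
  show ?thesis
  proof
    show "(\<lambda>x. inv\<^bsub>G\<^esub> x) ` boundary G A \<subseteq> boundary G A" using closed by auto
    show "boundary G A \<subseteq> (\<lambda>x. inv\<^bsub>G\<^esub> x) ` boundary G A"
    proof
      fix s assume s: "s \<in> boundary G A"
      then have "s = inv\<^bsub>G\<^esub> (inv\<^bsub>G\<^esub> s)" using sub by auto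
      then show "s \<in> (\<lambda>x. inv\<^bsub>G\<^esub> x) ` boundary G A"
        using closed[OF s] by (rule image_eqI)
    qed
  qed
qed


section \<open>The two generators\<close>

datatype gen = Gen_a | Gen_b

end

theory Submission
  imports Defs "HOL-Algebra.Coset"
begin

text \<open>
  The group is the group of affine maps \<open>x \<mapsto> c x + d\<close> of \<open>\<int>/7\<close> with \<open>c \<in> {1, 2, 4}\<close>. A set is
  independent if and only if the translates \<open>A u\<close> of \<open>A = {e, a, b}\<close> by its elements are disjoint.
  Let \<open>n\<^sub>c\<close> be the number of elements with linear part \<open>c\<close> of an independent set. The
  translates of these elements by \<open>e\<close> and \<open>a\<close>, and those of the elements with linear part \<open>c/2\<close> by
  \<open>b\<close>, are distinct elements of a coset of \<open>\<langle>a\<rangle>\<close>, so \<open>2 n\<^sub>c + n\<^bsub>c/2\<^esub> \<le> 7\<close>. The three inequalities sum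
  to \<open>3 (n\<^sub>1 + n\<^sub>2 + n\<^sub>4) \<le> 21\<close>, and equality would force \<open>9 n\<^sub>1 = 21\<close>. A maximal independent
  set is dominating and closed neighbourhoods have \<open>7\<close> elements, so it has at least \<open>21/7\<close> elements.
\<close>

section \<open>Graph isomorphisms\<close>

lemma independent_set_image_iff:
  assumes f: "bij_betw f (fst \<Gamma>) (fst \<Delta>)"
    and E: "\<forall>u\<in>fst \<Gamma>. \<forall>v\<in>fst \<Gamma>. {f u, f v} \<in> snd \<Delta> \<longleftrightarrow> {u, v} \<in> snd \<Gamma>"
    and I: "I \<subseteq> fst \<Gamma>"
  shows "independent_set \<Delta> (f ` I) \<longleftrightarrow> independent_set \<Gamma> I"
proof -
  have "f ` I \<subseteq> fst \<Delta>"
    using f I by (auto simp: bij_betw_def)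
  moreover have "(\<forall>u\<in>f ` I. \<forall>v\<in>f ` I. {u, v} \<notin> snd \<Delta>) \<longleftrightarrow> (\<forall>u\<in>I. \<forall>v\<in>I. {u, v} \<notin> snd \<Gamma>)"
    using E I by blast
  ultimately show ?thesis
    using I by (simp add: independent_set_def)
qed

lemma independent_sets_image:
  assumes f: "bij_betw f (fst \<Gamma>) (fst \<Delta>)"
    and E: "\<forall>u\<in>fst \<Gamma>. \<forall>v\<in>fst \<Gamma>. {f u, f v} \<in> snd \<Delta> \<longleftrightarrow> {u, v} \<in> snd \<Gamma>"
  shows "{J. independent_set \<Delta> J} = (`) f ` {I. independent_set \<Gamma> I}"
proof (intro equalityI subsetI)
  fix J assume "J \<in> {J. independent_set \<Delta> J}"
  then have J: "independent_set \<Delta> J" "J \<subseteq> f ` fst \<Gamma>"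
    using f by (auto simp: independent_set_def bij_betw_def)
  then obtain I where I: "I \<subseteq> fst \<Gamma>" "J = f ` I"
    by (auto simp: subset_image_iff)
  then show "J \<in> (`) f ` {I. independent_set \<Gamma> I}"
    using J(1) independent_set_image_iff[OF f E I(1)] by auto
next
  fix J assume "J \<in> (`) f ` {I. independent_set \<Gamma> I}"
  then show "J \<in> {J. independent_set \<Delta> J}"
    using independent_set_image_iff[OF f E] by (auto simp: independent_set_def)
qed

text \<open>Maximality only compares independent sets with one another, and these correspond by
  \<open>independent_sets_image\<close>. Since \<open>f\<close> is injective on the vertices, taking
  images preserves and reflects inclusion and equality.\<close>

lemma maximal_independent_sets_image:
  assumes f: "bij_betw f (fst \<Gamma>) (fst \<Delta>)"
    and E: "\<forall>u\<in>fst \<Gamma>. \<forall>v\<in>fst \<Gamma>. {f u, f v} \<in> snd \<Delta> \<longleftrightarrow> {u, v} \<in> snd \<Gamma>"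
  shows "{J. maximal_independent_set \<Delta> J} = (`) f ` {I. maximal_independent_set \<Gamma> I}"
proof -
  note img = independent_sets_image[OF f E]
  have inj: "inj_on f (fst \<Gamma>)"
    using f by (simp add: bij_betw_def)
  have max_iff: "maximal_independent_set \<Delta> (f ` I) \<longleftrightarrow> maximal_independent_set \<Gamma> I"
    if I: "independent_set \<Gamma> I" for I
  proof -
    have eq: "(f ` I \<subseteq> f ` J \<longrightarrow> f ` J = f ` I) \<longleftrightarrow> (I \<subseteq> J \<longrightarrow> J = I)"
      if "independent_set \<Gamma> J" for J
    proof -
      have sub: "I \<subseteq> fst \<Gamma>" "J \<subseteq> fst \<Gamma>"
        using I that by (simp_all add: independent_set_def)
      then have "f ` I \<subseteq> f ` J \<longleftrightarrow> I \<subseteq> J"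
        using inj_on_image_mem_iff[OF inj _ sub(2)] by (metis image_mono image_subset_iff subset_iff)
      then show ?thesis
        using inj_on_image_eq_iff[OF inj sub(2,1)] by simp
    qed
    \<comment> \<open>The quantifier is bounded by the set of all independent sets of
      \<open>\<Delta>\<close>, so that \<open>img\<close> can rewrite it into one over
      images.\<close>
    have "maximal_independent_set \<Delta> (f ` I) \<longleftrightarrow>
        f ` I \<in> {J. independent_set \<Delta> J} \<and>
        (\<forall>J\<in>{J. independent_set \<Delta> J}. f ` I \<subseteq> J \<longrightarrow> J = f ` I)"
      unfolding maximal_independent_set_def by (simp add: imp_conjL)
    also have "\<dots> \<longleftrightarrow> (\<forall>J\<in>{J. independent_set \<Gamma> J}. f ` I \<subseteq> f ` J \<longrightarrow> f ` J = f ` I)"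
      unfolding img using I by auto
    also have "\<dots> \<longleftrightarrow> (\<forall>J\<in>{J. independent_set \<Gamma> J}. I \<subseteq> J \<longrightarrow> J = I)"
      by (intro ball_cong) (simp_all add: eq)
    also have "\<dots> \<longleftrightarrow> maximal_independent_set \<Gamma> I"
      unfolding maximal_independent_set_def using I by (simp add: imp_conjL)
    finally show ?thesis .
  qed
  have "{J. maximal_independent_set \<Delta> J} =
      {J \<in> {J. independent_set \<Delta> J}. maximal_independent_set \<Delta> J}"
    by (simp add: maximal_independent_set_def)
  also have "\<dots> = (`) f ` {I \<in> {I. independent_set \<Gamma> I}. maximal_independent_set \<Delta> (f ` I)}"
    unfolding img by blast
  also have "{I \<in> {I. independent_set \<Gamma> I}. maximal_independent_set \<Delta> (f ` I)} =
      {I. maximal_independent_set \<Gamma> I}"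
    using max_iff by (auto simp only: maximal_independent_set_def[of \<Gamma>])
  finally show ?thesis .
qed

lemma independence_numbers_iso:
  assumes f: "bij_betw f (fst \<Gamma>) (fst \<Delta>)"
    and E: "\<forall>u\<in>fst \<Gamma>. \<forall>v\<in>fst \<Gamma>. {f u, f v} \<in> snd \<Delta> \<longleftrightarrow> {u, v} \<in> snd \<Gamma>"
  shows "independence_number \<Delta> = independence_number \<Gamma>"
    and "independent_domination_number \<Delta> = independent_domination_number \<Gamma>"
proof -
  have card: "card (f ` I) = card I" if "independent_set \<Gamma> I" for I
    using that f by (intro card_image) (auto simp: independent_set_def bij_betw_def inj_on_subset)
  have "card ` {J. independent_set \<Delta> J} = card ` {I. independent_set \<Gamma> I}"
    unfolding independent_sets_image[OF f E] image_image
    by (intro image_cong) (simp_all add: card)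
  then show "independence_number \<Delta> = independence_number \<Gamma>"
    by (simp add: independence_number_def)
  have "card (f ` I) = card I" if "maximal_independent_set \<Gamma> I" for I
    using that card by (simp add: maximal_independent_set_def)
  then have "card ` {J. maximal_independent_set \<Delta> J} = card ` {I. maximal_independent_set \<Gamma> I}"
    unfolding maximal_independent_sets_image[OF f E] image_image
    by (intro image_cong) simp_all
  then show "independent_domination_number \<Delta> = independent_domination_number \<Gamma>"
    by (simp add: independent_domination_number_def)
qed

lemma finite_independent_sets:
  assumes "finite (fst \<Gamma>)"
  shows "finite {I. independent_set \<Gamma> I}" and "finite {I. maximal_independent_set \<Gamma> I}"
proof -
  have "{I. independent_set \<Gamma> I} \<subseteq> Pow (fst \<Gamma>)"
    by (auto simp: independent_set_def)
  then show fin: "finite {I. independent_set \<Gamma> I}"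
    using assms finite_subset by blast
  show "finite {I. maximal_independent_set \<Gamma> I}"
    by (rule finite_subset[OF _ fin]) (auto simp: maximal_independent_set_def)
qed

section \<open>Cayley graphs\<close>

text \<open>Edges are unordered while \<open>S\<close> is arbitrary here, so either of the two
  quotients may be the one lying in \<open>S\<close>.\<close>

lemma cayley_graph_edge_iff:
  "{u, v} \<in> snd (cayley_graph G S) \<longleftrightarrow> u \<in> carrier G \<and> v \<in> carrier G \<and>
    (v \<otimes>\<^bsub>G\<^esub> inv\<^bsub>G\<^esub> u \<in> S \<or> u \<otimes>\<^bsub>G\<^esub> inv\<^bsub>G\<^esub> v \<in> S)"
  unfolding cayley_graph_def by (auto simp: doubleton_eq_iff)

lemma independent_set_cayley_graph_iff:
  "independent_set (cayley_graph G S) I \<longleftrightarrow>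
    I \<subseteq> carrier G \<and> (\<forall>u\<in>I. \<forall>v\<in>I. v \<otimes>\<^bsub>G\<^esub> inv\<^bsub>G\<^esub> u \<notin> S)"
  unfolding independent_set_def cayley_graph_edge_iff by (auto simp: cayley_graph_def)

text \<open>An isomorphism commutes with the quotients \<open>x\<^sup>-\<^sup>1 y\<close>, and by
  injectivity only the identity is sent to the identity.\<close>

lemma boundary_image_iso:
  assumes "group G" "group H" and h: "h \<in> iso G H" and A: "A \<subseteq> carrier G"
  shows "h ` boundary G A = boundary H (h ` A)"
proof -
  interpret group_hom G H h
    using assms by (simp add: group_hom_def group_hom_axioms_def iso_def)
  have inj: "inj_on h (carrier G)"
    using h by (simp add: iso_def bij_betw_def)
  have "h ` {inv\<^bsub>G\<^esub> x \<otimes>\<^bsub>G\<^esub> y |x y. x \<in> A \<and> y \<in> A} =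
      {inv\<^bsub>H\<^esub> x \<otimes>\<^bsub>H\<^esub> y |x y. x \<in> h ` A \<and> y \<in> h ` A}" (is "h ` ?L = ?R")
  proof -
    have eq: "h (inv\<^bsub>G\<^esub> x \<otimes>\<^bsub>G\<^esub> y) = inv\<^bsub>H\<^esub> h x \<otimes>\<^bsub>H\<^esub> h y" if "x \<in> A" "y \<in> A" for x y
      using that A by (simp add: subset_iff)
    show ?thesis
    proof (intro equalityI subsetI)
      fix z assume "z \<in> h ` ?L"
      then show "z \<in> ?R" using eq by blast
    next
      fix z assume "z \<in> ?R"
      then obtain x y where "x \<in> A" "y \<in> A" "z = inv\<^bsub>H\<^esub> h x \<otimes>\<^bsub>H\<^esub> h y"
        by blast
      then show "z \<in> h ` ?L"
        by (intro image_eqI[of _ _ "inv\<^bsub>G\<^esub> x \<otimes>\<^bsub>G\<^esub> y"]) (auto simp: eq)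
    qed
  qed
  moreover have "h ` (?L - {\<one>\<^bsub>G\<^esub>}) = h ` ?L - h ` {\<one>\<^bsub>G\<^esub>}"
    using A by (intro inj_on_image_set_diff[OF inj]) auto
  ultimately show ?thesis
    by (simp add: boundary_def)
qed

lemma cayley_boundary_numbers_iso:
  assumes "group G" "group H" and h: "h \<in> iso G H" and A: "A \<subseteq> carrier G"
  defines "\<Gamma> \<equiv> cayley_graph G (boundary G A)" and "\<Delta> \<equiv> cayley_graph H (boundary H (h ` A))"
  shows "independence_number \<Delta> = independence_number \<Gamma>"
    and "independent_domination_number \<Delta> = independent_domination_number \<Gamma>"
proof -
  interpret group_hom G H h
    using assms by (simp add: group_hom_def group_hom_axioms_def iso_def)
  have bij: "bij_betw h (fst \<Gamma>) (fst \<Delta>)"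
    using h by (simp add: iso_def \<Gamma>_def \<Delta>_def cayley_graph_def)
  have sub: "boundary G A \<subseteq> carrier G"
    using A by (auto simp: boundary_def)
  have mem: "h v \<otimes>\<^bsub>H\<^esub> inv\<^bsub>H\<^esub> h u \<in> boundary H (h ` A) \<longleftrightarrow> v \<otimes>\<^bsub>G\<^esub> inv\<^bsub>G\<^esub> u \<in> boundary G A"
    if "u \<in> carrier G" "v \<in> carrier G" for u v
  proof -
    have "h v \<otimes>\<^bsub>H\<^esub> inv\<^bsub>H\<^esub> h u = h (v \<otimes>\<^bsub>G\<^esub> inv\<^bsub>G\<^esub> u)"
      using that by simp
    moreover have "inj_on h (carrier G)"
      using h by (simp add: iso_def bij_betw_def)
    ultimately show ?thesis
      unfolding boundary_image_iso[OF assms(1-4), symmetric]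
      using that sub inj_on_image_mem_iff[of h "carrier G" "v \<otimes>\<^bsub>G\<^esub> inv\<^bsub>G\<^esub> u"] by simp
  qed
  have E: "\<forall>u\<in>fst \<Gamma>. \<forall>v\<in>fst \<Gamma>. {h u, h v} \<in> snd \<Delta> \<longleftrightarrow> {u, v} \<in> snd \<Gamma>"
    using mem by (simp add: \<Gamma>_def \<Delta>_def cayley_graph_edge_iff) (simp add: cayley_graph_def)
  show "independence_number \<Delta> = independence_number \<Gamma>"
    and "independent_domination_number \<Delta> = independent_domination_number \<Gamma>"
    by (rule independence_numbers_iso[OF bij E])+
qed

text \<open>If \<open>x u = y v\<close>, then the quotient of \<open>u\<close> by \<open>v\<close>
  equals \<open>x\<^sup>-\<^sup>1 y\<close>. Independence keeps it out of the boundary, so it must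
  be the identity.\<close>

lemma independent_set_inj_on_translates:
  assumes "group G" and A: "A \<subseteq> carrier G"
    and I: "independent_set (cayley_graph G (boundary G A)) I"
  shows "inj_on (\<lambda>(x, u). x \<otimes>\<^bsub>G\<^esub> u) (A \<times> I)"
proof -
  interpret group G by fact
  have IG: "I \<subseteq> carrier G"
    using I by (simp add: independent_set_cayley_graph_iff)
  have "x = y \<and> u = v"
    if xy: "x \<in> A" "y \<in> A" and uv: "u \<in> I" "v \<in> I" and eq: "x \<otimes>\<^bsub>G\<^esub> u = y \<otimes>\<^bsub>G\<^esub> v" for x y u v
  proof -
    have c: "x \<in> carrier G" "y \<in> carrier G" "u \<in> carrier G" "v \<in> carrier G"
      using xy uv A IG by auto
    have "u = inv\<^bsub>G\<^esub> x \<otimes>\<^bsub>G\<^esub> (y \<otimes>\<^bsub>G\<^esub> v)"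
      using c eq by (metis inv_solve_left m_closed)
    then have q: "u \<otimes>\<^bsub>G\<^esub> inv\<^bsub>G\<^esub> v = inv\<^bsub>G\<^esub> x \<otimes>\<^bsub>G\<^esub> y"
      using c by (simp add: m_assoc)
    have "inv\<^bsub>G\<^esub> x \<otimes>\<^bsub>G\<^esub> y \<notin> boundary G A"
      using I uv unfolding q[symmetric] by (simp add: independent_set_cayley_graph_iff)
    then have "inv\<^bsub>G\<^esub> x \<otimes>\<^bsub>G\<^esub> y = \<one>\<^bsub>G\<^esub>"
      using xy by (auto simp: boundary_def)
    then have "x = y"
      using c by (metis inv_solve_left' one_closed r_one)
    then show ?thesis
      using eq c by simp
  qed
  then show ?thesis
    by (auto simp: inj_on_def)
qed

text \<open>A vertex added to a dominating set would be adjacent to one of its members.\<close>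

lemma maximal_independent_set_cayley_graph:
  assumes I: "independent_set (cayley_graph G S) I"
    and dom: "\<And>v. v \<in> carrier G \<Longrightarrow> \<exists>u\<in>I. v = u \<or> v \<otimes>\<^bsub>G\<^esub> inv\<^bsub>G\<^esub> u \<in> S"
  shows "maximal_independent_set (cayley_graph G S) I"
  using assms unfolding maximal_independent_set_def independent_set_cayley_graph_iff by blast

text \<open>An undominated vertex could be added to the set, contradicting maximality.\<close>

lemma maximal_independent_set_dominating:
  assumes "group G" and A: "A \<subseteq> carrier G"
    and I: "maximal_independent_set (cayley_graph G (boundary G A)) I" and v: "v \<in> carrier G"
  shows "\<exists>u\<in>I. v = u \<or> v \<otimes>\<^bsub>G\<^esub> inv\<^bsub>G\<^esub> u \<in> boundary G A"
proof (rule ccontr)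
  interpret group G by fact
  let ?S = "boundary G A"
  assume neg: "\<not> (\<exists>u\<in>I. v = u \<or> v \<otimes>\<^bsub>G\<^esub> inv\<^bsub>G\<^esub> u \<in> ?S)"
  have ind: "independent_set (cayley_graph G ?S) I"
    and max: "\<And>J. independent_set (cayley_graph G ?S) J \<Longrightarrow> I \<subseteq> J \<Longrightarrow> J = I"
    using I by (auto simp: maximal_independent_set_def)
  have IG: "I \<subseteq> carrier G"
    using ind by (simp add: independent_set_cayley_graph_iff)
  \<comment> \<open>\<open>neg\<close> excludes only the opposite quotient; closure of the boundary
    under inverses excludes this one.\<close>
  have "u \<otimes>\<^bsub>G\<^esub> inv\<^bsub>G\<^esub> v \<notin> ?S" if "u \<in> I" for u
  proof
    assume "u \<otimes>\<^bsub>G\<^esub> inv\<^bsub>G\<^esub> v \<in> ?S"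
    then have "inv\<^bsub>G\<^esub> (u \<otimes>\<^bsub>G\<^esub> inv\<^bsub>G\<^esub> v) \<in> ?S"
      using inv_boundary[OF assms(1) A] by blast
    moreover have "inv\<^bsub>G\<^esub> (u \<otimes>\<^bsub>G\<^esub> inv\<^bsub>G\<^esub> v) = v \<otimes>\<^bsub>G\<^esub> inv\<^bsub>G\<^esub> u"
      using that IG v by (simp add: inv_mult_group subset_iff)
    ultimately show False
      using neg that by auto
  qed
  moreover have "v \<otimes>\<^bsub>G\<^esub> inv\<^bsub>G\<^esub> v \<notin> ?S"
    using v by (simp add: one_notin_boundary)
  ultimately have "independent_set (cayley_graph G ?S) (insert v I)"
    using ind neg v by (auto simp: independent_set_cayley_graph_iff)
  then have "insert v I = I"
    by (rule max) auto
  then show False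
    using neg by auto
qed

text \<open>By domination the closed neighbourhoods of the elements of \<open>I\<close> cover the
  group. Each is a right translate of the boundary with the identity added, which explains the
  \<open>Suc\<close>.\<close>

lemma card_maximal_independent_set_ge:
  assumes "group G" and A: "A \<subseteq> carrier G" and fin: "finite (carrier G)"
    and I: "maximal_independent_set (cayley_graph G (boundary G A)) I"
  shows "card (carrier G) \<le> Suc (card (boundary G A)) * card I"
proof -
  interpret group G by fact
  let ?B = "insert \<one>\<^bsub>G\<^esub> (boundary G A)"
  have IG: "I \<subseteq> carrier G"
    using I by (simp add: maximal_independent_set_def independent_set_cayley_graph_iff)
  have "boundary G A \<subseteq> carrier G"
    using A by (auto simp: boundary_def)
  then have finB: "finite ?B" and finI: "finite I"
    using fin IG finite_subset by auto
  have "carrier G \<subseteq> (\<lambda>(s, u). s \<otimes>\<^bsub>G\<^esub> u) ` (?B \<times> I)"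
  proof
    fix v assume v: "v \<in> carrier G"
    then obtain u where u: "u \<in> I" "v = u \<or> v \<otimes>\<^bsub>G\<^esub> inv\<^bsub>G\<^esub> u \<in> boundary G A"
      using maximal_independent_set_dominating[OF assms(1) A I] by blast
    then have uG: "u \<in> carrier G" using IG by auto
    have "v \<otimes>\<^bsub>G\<^esub> inv\<^bsub>G\<^esub> u \<in> ?B"
      using u(2) uG by auto
    moreover have "v = (v \<otimes>\<^bsub>G\<^esub> inv\<^bsub>G\<^esub> u) \<otimes>\<^bsub>G\<^esub> u"
      using v uG by (simp add: m_assoc)
    ultimately show "v \<in> (\<lambda>(s, u). s \<otimes>\<^bsub>G\<^esub> u) ` (?B \<times> I)"
      using u(1) by force
  qed
  then have "card (carrier G) \<le> card (?B \<times> I)"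
    using finB finI by (intro surj_card_le) auto
  also have "\<dots> = Suc (card (boundary G A)) * card I"
    using finB by (simp add: card_cartesian_product one_notin_boundary)
  finally show ?thesis .
qed

section \<open>The affine group\<close>

text \<open>The pair \<open>(d, c)\<close> stands for the map \<open>x \<mapsto> c x + d\<close> of \<open>\<int>/7\<close>.\<close>

definition affine21 :: "(int \<times> int) monoid" where
  "affine21 =
    \<lparr>carrier = {0..<7} \<times> {1, 2, 4},
     mult = (\<lambda>(d, c) (d', c'). ((d + c * d') mod 7, (c * c') mod 7)),
     one = (0, 1)\<rparr>"

lemma carrier_affine21: "carrier affine21 = {0..<7} \<times> {1, 2, 4}"
  and mult_affine21: "(d, c) \<otimes>\<^bsub>affine21\<^esub> (d', c') = ((d + c * d') mod 7, (c * c') mod 7)"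
  and one_affine21: "\<one>\<^bsub>affine21\<^esub> = (0, 1)"
  by (simp_all add: affine21_def)

lemma card_carrier_affine21: "card (carrier affine21) = 21"
  by (simp add: carrier_affine21 card_cartesian_product)

text \<open>Each of 1, 2, 4 has cube 1 modulo 7, so the inverse of \<open>c\<close> is its square,
  and the inverse map sends \<open>x\<close> to \<open>c\<^sup>2 x - c\<^sup>2 d\<close>.\<close>

lemma affine21_left_inverse:
  assumes "(d, c) \<in> carrier affine21"
  shows "((- (c * c * d)) mod 7, (c * c) mod 7) \<in> carrier affine21"
    and "((- (c * c * d)) mod 7, (c * c) mod 7) \<otimes>\<^bsub>affine21\<^esub> (d, c) = \<one>\<^bsub>affine21\<^esub>"
  using assms by (auto simp: carrier_affine21 mult_affine21 one_affine21 mod_simps)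

lemma group_affine21: "group affine21"
proof (rule groupI)
  fix x y assume "x \<in> carrier affine21" "y \<in> carrier affine21"
  then show "x \<otimes>\<^bsub>affine21\<^esub> y \<in> carrier affine21"
    by (auto simp: carrier_affine21 mult_affine21)
next
  fix x y z :: "int \<times> int"
  \<comment> \<open>These are the translation parts of the two bracketings of a triple product, with
    \<open>q\<close> and \<open>s\<close> the linear parts of the first two factors.\<close>
  have "((p + q * r) mod 7 + (q * s) mod 7 * t) mod 7 = (p + q * ((r + s * t) mod 7)) mod 7"
    for p q r s t :: int
  proof -
    have "((p + q * r) mod 7 + (q * s) mod 7 * t) mod 7 = (p + q * r + q * s * t) mod 7"
      by (intro mod_add_cong) (simp_all add: mod_mult_left_eq)
    also have "p + q * r + q * s * t = p + q * (r + s * t)"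
      by (simp add: algebra_simps)
    also have "\<dots> mod 7 = (p + q * ((r + s * t) mod 7)) mod 7"
      by (intro mod_add_cong) (simp_all add: mod_mult_right_eq)
    finally show ?thesis .
  qed
  then show "x \<otimes>\<^bsub>affine21\<^esub> y \<otimes>\<^bsub>affine21\<^esub> z = x \<otimes>\<^bsub>affine21\<^esub> (y \<otimes>\<^bsub>affine21\<^esub> z)"
    by (cases x; cases y; cases z) (simp add: mult_affine21 mod_mult_left_eq mod_mult_right_eq mult.assoc)
next
  fix x assume "x \<in> carrier affine21"
  then show "\<exists>y\<in>carrier affine21. y \<otimes>\<^bsub>affine21\<^esub> x = \<one>\<^bsub>affine21\<^esub>"
    using affine21_left_inverse by (cases x) blast
qed (auto simp: carrier_affine21 mult_affine21 one_affine21)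

lemma inv_affine21:
  assumes "(d, c) \<in> carrier affine21"
  shows "inv\<^bsub>affine21\<^esub> (d, c) = ((- (c * c * d)) mod 7, (c * c) mod 7)"
  using group.inv_equality[OF group_affine21 affine21_left_inverse(2)[OF assms] assms]
    affine21_left_inverse(1)[OF assms] by simp

text \<open>The intended images of \<open>e\<close>, \<open>a\<close>, \<open>b\<close>: the
  identity, the translation by 1 and the doubling map. Conjugating the translation by the doubling
  gives the translation by 2, as the last relation demands.\<close>

definition affine_A :: "(int \<times> int) set" where
  "affine_A = {(0, 1), (1, 1), (0, 2)}"

lemma affine_A_subset: "affine_A \<subseteq> carrier affine21"
  by (simp add: affine_A_def carrier_affine21)

text \<open>Of the nine quotients three are the identity and the other six are distinct, so closed
  neighbourhoods have seven vertices.\<close>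

lemma boundary_affine_A:
  "boundary affine21 affine_A = {(1, 1), (6, 1), (0, 2), (0, 4), (6, 2), (4, 4)}"
proof -
  have "{inv\<^bsub>affine21\<^esub> x \<otimes>\<^bsub>affine21\<^esub> y |x y. x \<in> affine_A \<and> y \<in> affine_A} =
      (\<Union>x\<in>affine_A. \<Union>y\<in>affine_A. {inv\<^bsub>affine21\<^esub> x \<otimes>\<^bsub>affine21\<^esub> y})"
    by blast
  also have "\<dots> = {(0, 1), (1, 1), (6, 1), (0, 2), (0, 4), (6, 2), (4, 4)}"
    by (auto simp: affine_A_def inv_affine21 carrier_affine21 mult_affine21)
  finally show ?thesis
    by (simp add: boundary_def one_affine21)
qed

section \<open>The two numbers of the affine graph\<close>

abbreviation affine_graph :: "(int \<times> int) simple_graph" where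
  "affine_graph \<equiv> cayley_graph affine21 (boundary affine21 affine_A)"

text \<open>Left multiplication by \<open>e\<close> and \<open>a\<close> keeps the linear part and
  \<open>b\<close> doubles it, so the disjoint translates collected in \<open>?T\<close> all fall
  among the seven pairs with second component \<open>c\<close>.\<close>

lemma card_independent_level:
  assumes I: "independent_set affine_graph I" and c: "(2 * d) mod 7 = c"
  shows "2 * card {u \<in> I. snd u = c} + card {u \<in> I. snd u = d} \<le> 7"
proof -
  have IF: "I \<subseteq> carrier affine21"
    using I by (simp add: independent_set_cayley_graph_iff)
  then have fin: "finite I"
    by (rule finite_subset) (simp add: carrier_affine21)
  let ?I = "\<lambda>c. {u \<in> I. snd u = c}"
  let ?T = "{(0 :: int, 1 :: int), (1, 1)} \<times> ?I c \<union> {(0, 2)} \<times> ?I d"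
  let ?m = "\<lambda>(x, u). x \<otimes>\<^bsub>affine21\<^esub> u"
  have "inj_on ?m ?T"
    by (rule inj_on_subset[OF independent_set_inj_on_translates[OF group_affine21 affine_A_subset I]])
      (auto simp: affine_A_def)
  moreover have "?m ` ?T \<subseteq> {0..<7} \<times> {c}"
    using IF c by (auto simp: carrier_affine21 mult_affine21)
  ultimately have "card ?T \<le> card ({0..<7::int} \<times> {c})"
    by (rule card_inj_on_le) simp
  moreover have "card ?T = card ({(0::int, 1::int), (1, 1)} \<times> ?I c) + card ({(0::int, 2::int)} \<times> ?I d)"
    using fin by (intro card_Un_disjoint) auto
  ultimately show ?thesis
    by (simp add: card_cartesian_product)
qed

lemma card_independent_affine_le:
  assumes I: "independent_set affine_graph I"
  shows "card I \<le> 6"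
proof -
  let ?I = "\<lambda>c. {u \<in> I. snd u = c}"
  have IF: "I \<subseteq> carrier affine21"
    using I by (simp add: independent_set_cayley_graph_iff)
  then have fin: "finite I"
    by (rule finite_subset) (simp add: carrier_affine21)
  have "I = ?I 1 \<union> ?I 2 \<union> ?I 4"
    using IF by (auto simp: carrier_affine21)
  then have "card I = card (?I 1 \<union> ?I 2 \<union> ?I 4)"
    by (rule arg_cong)
  also have "\<dots> = card (?I 1) + card (?I 2) + card (?I 4)"
    using fin by (subst card_Un_disjoint; auto)+
  finally have "card I = card (?I 1) + card (?I 2) + card (?I 4)" .
  moreover have "x + y + z \<le> 6" if "2 * y + x \<le> 7" "2 * z + y \<le> 7" "2 * x + z \<le> 7" for x y z :: nat
    using that by presburger
  \<comment> \<open>Doubling modulo 7 permutes the linear parts cyclically, 1 to 2 to 4 to 1, which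
    gives the three inequalities.\<close>
  ultimately show ?thesis
    using card_independent_level[OF I, of 1 2] card_independent_level[OF I, of 2 4]
      card_independent_level[OF I, of 4 1] by simp
qed

lemma independence_number_affine: "independence_number affine_graph = 6"
proof -
  \<comment> \<open>The witness is the union of the left cosets by \<open>e\<close> and
    \<open>a\<^sup>3\<close> of the order 3 subgroup generated by
    \<open>a b = (1, 2)\<close>.\<close>
  let ?J = "{(0, 1), (3, 1), (1, 2), (4, 2), (3, 4), (6, 4)} :: (int \<times> int) set"
  have "independent_set affine_graph ?J"
    unfolding independent_set_cayley_graph_iff boundary_affine_A
    by (simp add: carrier_affine21 inv_affine21 mult_affine21)
  moreover have "card ?J = 6" by simp
  ultimately have "6 \<in> card ` {I. independent_set affine_graph I}"
    by (metis imageI mem_Collect_eq)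
  moreover have "finite {I. independent_set affine_graph I}"
    by (rule finite_independent_sets) (simp add: cayley_graph_def carrier_affine21)
  ultimately show ?thesis
    unfolding independence_number_def using card_independent_affine_le
    by (intro Max_eqI) auto
qed

lemma independent_domination_number_affine: "independent_domination_number affine_graph = 3"
proof -
  \<comment> \<open>The witness is the order 3 subgroup generated by
    \<open>a\<^sup>3 b = (3, 2)\<close>; its three closed neighbourhoods of size 7 partition the 21
    vertices.\<close>
  let ?J = "{(0, 1), (3, 2), (2, 4)} :: (int \<times> int) set"
  have ind: "independent_set affine_graph ?J"
    unfolding independent_set_cayley_graph_iff boundary_affine_A
    by (simp add: carrier_affine21 inv_affine21 mult_affine21)
  have seven: "{0..<7::int} = {0, 1, 2, 3, 4, 5, 6}"
    by auto
  have "\<forall>v\<in>carrier affine21. \<exists>u\<in>?J.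
      v = u \<or> v \<otimes>\<^bsub>affine21\<^esub> inv\<^bsub>affine21\<^esub> u \<in> boundary affine21 affine_A"
    unfolding boundary_affine_A
    by (simp add: inv_affine21 carrier_affine21 mult_affine21 seven)
  then have "maximal_independent_set affine_graph ?J"
    by (intro maximal_independent_set_cayley_graph[OF ind]) blast
  moreover have "card ?J = 3" by simp
  ultimately have "3 \<in> card ` {I. maximal_independent_set affine_graph I}"
    by (metis imageI mem_Collect_eq)
  moreover have "finite {I. maximal_independent_set affine_graph I}"
    by (rule finite_independent_sets) (simp add: cayley_graph_def carrier_affine21)
  moreover have "3 \<le> card I" if "maximal_independent_set affine_graph I" for I
    using card_maximal_independent_set_ge[OF group_affine21 affine_A_subset _ that]
    by (simp add: card_carrier_affine21 boundary_affine_A) (simp add: carrier_affine21)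
  ultimately show ?thesis
    unfolding independent_domination_number_def by (intro Min_eqI) auto
qed

section \<open>The presented group\<close>

lemma presented_gen_closed: "presented_gen R x \<in> carrier (presented_group R)"
  by (simp add: presented_gen_def carrier_presented_group)

lemma inv_presented_gen: "inv\<^bsub>presented_group R\<^esub> (presented_gen R x) = word_class R [Neg x]"
proof (rule group.inv_equality[OF group_presented_group])
  show "word_class R [Neg x] \<otimes>\<^bsub>presented_group R\<^esub> presented_gen R x = \<one>\<^bsub>presented_group R\<^esub>"
    by (simp add: presented_gen_def mult_presented_group one_presented_group word_class_eq_iff
        word_eq.cancel_left)
qed (simp_all add: presented_gen_def carrier_presented_group)

text \<open>Every element is the class of a word, and a word is built from the left one letter at a
  time.\<close>

lemma presented_group_induct [consumes 1, case_names one gen inv_gen]: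
  assumes X: "X \<in> carrier (presented_group R)"
    and one: "P \<one>\<^bsub>presented_group R\<^esub>"
    and gen: "\<And>x X. X \<in> carrier (presented_group R) \<Longrightarrow> P X \<Longrightarrow>
      P (presented_gen R x \<otimes>\<^bsub>presented_group R\<^esub> X)"
    and inv_gen: "\<And>x X. X \<in> carrier (presented_group R) \<Longrightarrow> P X \<Longrightarrow>
      P (inv\<^bsub>presented_group R\<^esub> (presented_gen R x) \<otimes>\<^bsub>presented_group R\<^esub> X)"
  shows "P X"
proof -
  obtain w where w: "X = word_class R w"
    using X by (auto simp: carrier_presented_group)
  have "P (word_class R w)"
  proof (induction w)
    case Nil
    then show ?case using one by (simp add: one_presented_group)
  next
    case (Cons l w)
    have c: "word_class R w \<in> carrier (presented_group R)"
      by (simp add: carrier_presented_group)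
    show ?case
      using gen[OF c Cons.IH] inv_gen[OF c Cons.IH]
      by (cases l) (simp_all add: presented_gen_def[symmetric] inv_presented_gen,
        simp_all add: presented_gen_def mult_presented_group)
  qed
  then show ?thesis by (simp add: w)
qed

text \<open>Evaluating a word at the generators themselves returns its class; this turns the
  relations in \<open>R\<close> into equations between products of generators.\<close>

lemma word_val_in_presented_group: "word_class R w = word_val (presented_group R) (presented_gen R) w"
proof (induction w)
  case Nil
  then show ?case by (simp add: word_val_def one_presented_group)
next
  case (Cons l w)
  have l: "letter_val (presented_group R) (presented_gen R) l = word_class R [l]"
    by (cases l) (simp_all add: inv_presented_gen, simp add: presented_gen_def)
  have "word_class R (l # w) = word_class R [l] \<otimes>\<^bsub>presented_group R\<^esub> word_class R w"
    by (simp add: mult_presented_group)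
  also have "\<dots> = word_val (presented_group R) (presented_gen R) (l # w)"
    unfolding l[symmetric] Cons by (simp add: word_val_def)
  finally show ?case .
qed

section \<open>Normal forms under the relation \<open>b a = a\<^sup>2 b\<close>\<close>

context group
begin

text \<open>Moving \<open>b\<close> to the right past one \<open>a\<close> turns that
  \<open>a\<close> into two.\<close>

lemma conj_square_commute_pow:
  assumes a: "a \<in> carrier G" and b: "b \<in> carrier G" and ba: "b \<otimes> a = a \<otimes> a \<otimes> b"
  shows "b \<otimes> a [^] (i::nat) = a [^] (2 * i) \<otimes> b"
proof (induction i)
  case 0
  then show ?case using b by simp
next
  case (Suc i)
  have "b \<otimes> a [^] Suc i = (b \<otimes> a [^] i) \<otimes> a"
    using a b by (simp add: m_assoc)
  also have "\<dots> = a [^] (2 * i) \<otimes> (a \<otimes> a \<otimes> b)"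
    using a b by (simp add: Suc m_assoc flip: ba)
  also have "\<dots> = a [^] (2 * Suc i) \<otimes> b"
    using a b by (simp add: m_assoc)
  finally show ?case .
qed

text \<open>Closure of \<open>M\<close> under these four multiplications lets the induction on words
  show that \<open>M\<close> is the whole group. The exponent of \<open>a\<close> is left unreduced,
  so only that of \<open>b\<close> needs care.\<close>

lemma metacyclic_normal_form_mult:
  assumes a: "a \<in> carrier G" and b: "b \<in> carrier G" and ba: "b \<otimes> a = a \<otimes> a \<otimes> b"
    and a7: "a [^] (7::nat) = \<one>" and b3: "b [^] (3::nat) = \<one>"
  defines "M \<equiv> {a [^] i \<otimes> b [^] j |(i::nat) (j::nat). j < 3}"
  assumes x: "x \<in> M"
  shows "a \<otimes> x \<in> M" "b \<otimes> x \<in> M" "inv a \<otimes> x \<in> M" "inv b \<otimes> x \<in> M"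
proof -
  have am: "a \<otimes> x \<in> M" if "x \<in> M" for x
  proof -
    obtain i j :: nat where j: "j < 3" and x: "x = a [^] i \<otimes> b [^] j"
      using \<open>x \<in> M\<close> unfolding M_def by blast
    have "a \<otimes> x = a [^] Suc i \<otimes> b [^] j"
      using a b by (simp only: x nat_pow_Suc2[of a i] m_assoc nat_pow_closed)
    then show ?thesis using j unfolding M_def by blast
  qed
  have bm: "b \<otimes> x \<in> M" if "x \<in> M" for x
  proof -
    obtain i j :: nat where j: "j < 3" and x: "x = a [^] i \<otimes> b [^] j"
      using \<open>x \<in> M\<close> unfolding M_def by blast
    have "b \<otimes> x = (b \<otimes> a [^] i) \<otimes> b [^] j"
      using a b by (simp add: x m_assoc)
    also have "\<dots> = a [^] (2 * i) \<otimes> b [^] Suc j"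
      using a b by (simp only: conj_square_commute_pow[OF a b ba] m_assoc nat_pow_Suc2[of b j] nat_pow_closed)
    \<comment> \<open>The exponent 3 wraps around to 0, keeping the exponent of \<open>b\<close>
      below 3.\<close>
    also have "b [^] Suc j = b [^] (if j = 2 then 0 else Suc j)"
      using b3 by (simp add: numeral_3_eq_3 numeral_2_eq_2)
    finally have "b \<otimes> x = a [^] (2 * i) \<otimes> b [^] (if j = 2 then 0 else Suc j)" .
    moreover have "(if j = 2 then 0 else Suc j) < 3"
      using j by simp
    ultimately show ?thesis unfolding M_def by blast
  qed
  have xc: "x \<in> carrier G" if "x \<in> M" for x
    using that a b by (auto simp: M_def)
  have inv_a: "inv a = a [^] (6::nat)"
    using a a7 by (intro inv_equality) (simp_all add: flip: nat_pow_Suc)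
  have inv_b: "inv b = b [^] (2::nat)"
    using b b3 by (intro inv_equality) (simp_all add: flip: nat_pow_Suc)
  show "a \<otimes> x \<in> M" "b \<otimes> x \<in> M" by (fact am[OF x] bm[OF x])+
  \<comment> \<open>The inverse of \<open>a\<close> is its sixth power, so closure under
    \<open>a\<close> is applied six times.\<close>
  have "a \<otimes> (a \<otimes> (a \<otimes> (a \<otimes> (a \<otimes> (a \<otimes> x))))) \<in> M"
    by (intro am x)
  then show "inv a \<otimes> x \<in> M"
    using a xc[OF x] by (simp add: inv_a numeral_eq_Suc m_assoc)
  have "b \<otimes> (b \<otimes> x) \<in> M"
    by (intro bm x)
  then show "inv b \<otimes> x \<in> M"
    using b xc[OF x] by (simp add: inv_b numeral_eq_Suc m_assoc)
qed

end

section \<open>Identification of the presented group with the affine group\<close>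

lemma affine21_pow_translation:
  "(1, 1) [^]\<^bsub>affine21\<^esub> (i::nat) = (int i mod 7, 1)"
proof -
  interpret group affine21 by (rule group_affine21)
  show ?thesis
    by (induction i) (simp_all add: one_affine21 mult_affine21 mod_simps add.commute)
qed

text \<open>For these exponents \<open>2 ^ j\<close> is 1, 2 or 4 and hence already reduced modulo
  7.\<close>

lemma affine21_pow_dilation:
  "j < 3 \<Longrightarrow> (0, 2) [^]\<^bsub>affine21\<^esub> (j::nat) = (0, 2 ^ j)"
proof -
  interpret group affine21 by (rule group_affine21)
  assume "j < 3"
  then have "j \<in> {0, 1, 2}" by auto
  then show ?thesis
    by (auto simp: one_affine21 mult_affine21 numeral_2_eq_2)
qed

text \<open>The universal property supplies \<open>h\<close>. Every element has the form
  \<open>a\<^sup>i b\<^sup>j\<close> with \<open>j < 3\<close>, and its value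
  \<open>(i mod 7, 2\<^sup>j)\<close> shows both that the kernel is trivial and that
  \<open>h\<close> is onto.\<close>

lemma presented_group_iso_affine21:
  fixes R :: "(gen letter list \<times> gen letter list) set"
  assumes R: "R = {(replicate 7 (Pos Gen_a), []),
                   (replicate 3 (Pos Gen_b), []),
                   ([Pos Gen_b, Pos Gen_a, Neg Gen_b], [Pos Gen_a, Pos Gen_a])}"
  shows "\<exists>h \<in> iso (presented_group R) affine21.
    h (presented_gen R Gen_a) = (1, 1) \<and> h (presented_gen R Gen_b) = (0, 2)"
proof -
  let ?G = "presented_group R"
  let ?a = "presented_gen R Gen_a" and ?b = "presented_gen R Gen_b"
  interpret G: group ?G by (rule group_presented_group)
  interpret F: group affine21 by (rule group_affine21)
  let ?f = "\<lambda>x. case x of Gen_a \<Rightarrow> (1, 1) | Gen_b \<Rightarrow> (0::int, 2::int)"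
  have "?f x \<in> carrier affine21" for x
    by (cases x) (auto simp: carrier_affine21)
  moreover have "word_val affine21 ?f u = word_val affine21 ?f v" if "(u, v) \<in> R" for u v
    using that unfolding R
    by (auto simp: word_val_def inv_affine21 carrier_affine21 mult_affine21 one_affine21 numeral_eq_Suc)
  ultimately obtain h where h: "h \<in> hom ?G affine21" and hgen: "\<forall>x. h (presented_gen R x) = ?f x"
    using presented_group_universal[OF group_affine21] by metis
  interpret group_hom ?G affine21 h
    using h by unfold_locales
  have ha: "h ?a = (1, 1)" and hb: "h ?b = (0, 2)"
    using hgen by auto
  have a: "?a \<in> carrier ?G" and b: "?b \<in> carrier ?G"
    by (rule presented_gen_closed)+
  have rel: "word_val ?G (presented_gen R) u = word_val ?G (presented_gen R) v" if "(u, v) \<in> R" for u v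
    using word_eq.rel[OF that] by (simp flip: word_val_in_presented_group add: word_class_eq_iff)
  have R1: "(replicate 7 (Pos Gen_a), []) \<in> R" and R2: "(replicate 3 (Pos Gen_b), []) \<in> R"
    and R3: "([Pos Gen_b, Pos Gen_a, Neg Gen_b], [Pos Gen_a, Pos Gen_a]) \<in> R"
    by (simp_all add: R)
  have a7: "?a [^]\<^bsub>?G\<^esub> (7::nat) = \<one>\<^bsub>?G\<^esub>"
    using rel[OF R1] a by (simp add: word_val_def numeral_eq_Suc G.m_assoc)
  have b3: "?b [^]\<^bsub>?G\<^esub> (3::nat) = \<one>\<^bsub>?G\<^esub>"
    using rel[OF R2] b by (simp add: word_val_def numeral_eq_Suc G.m_assoc)
  \<comment> \<open>This is the third relation, bracketed as \<open>word_val\<close> produces it;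
    multiplying by \<open>b\<close> on the right yields the commutation rule
    \<open>ba\<close>.\<close>
  have "?b \<otimes>\<^bsub>?G\<^esub> (?a \<otimes>\<^bsub>?G\<^esub> inv\<^bsub>?G\<^esub> ?b) = ?a \<otimes>\<^bsub>?G\<^esub> ?a"
    using rel[OF R3] a b by (simp add: word_val_def)
  then have "?a \<otimes>\<^bsub>?G\<^esub> ?a \<otimes>\<^bsub>?G\<^esub> ?b = ?b \<otimes>\<^bsub>?G\<^esub> (?a \<otimes>\<^bsub>?G\<^esub> inv\<^bsub>?G\<^esub> ?b) \<otimes>\<^bsub>?G\<^esub> ?b"
    by simp
  also have "\<dots> = ?b \<otimes>\<^bsub>?G\<^esub> ?a"
    using a b by (simp add: G.m_assoc)
  finally have ba: "?b \<otimes>\<^bsub>?G\<^esub> ?a = ?a \<otimes>\<^bsub>?G\<^esub> ?a \<otimes>\<^bsub>?G\<^esub> ?b" ..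
  have normal: "X \<in> {?a [^]\<^bsub>?G\<^esub> i \<otimes>\<^bsub>?G\<^esub> ?b [^]\<^bsub>?G\<^esub> j |(i::nat) (j::nat). j < 3}"
    if "X \<in> carrier ?G" for X
    using that
  proof (induction rule: presented_group_induct)
    case one
    have "(0::nat) < 3" "\<one>\<^bsub>?G\<^esub> = ?a [^]\<^bsub>?G\<^esub> (0::nat) \<otimes>\<^bsub>?G\<^esub> ?b [^]\<^bsub>?G\<^esub> (0::nat)"
      by simp_all
    then show ?case by blast
  next
    case (gen x X)
    then show ?case
      using G.metacyclic_normal_form_mult(1,2)[OF a b ba a7 b3] by (cases x) auto
  next
    case (inv_gen x X)
    then show ?case
      using G.metacyclic_normal_form_mult(3,4)[OF a b ba a7 b3] by (cases x) auto
  qed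
  have val: "h (?a [^]\<^bsub>?G\<^esub> i \<otimes>\<^bsub>?G\<^esub> ?b [^]\<^bsub>?G\<^esub> j) = (int i mod 7, 2 ^ j)" if "j < 3" for i j :: nat
  proof -
    have "j \<in> {0, 1, 2}" using that by auto
    then show ?thesis
      using a b that by (auto simp: hom_nat_pow ha hb affine21_pow_translation affine21_pow_dilation mult_affine21)
  qed
  have "h \<in> iso ?G affine21"
    unfolding iso_iff
  proof (intro conjI ballI impI)
    \<comment> \<open>Trivial kernel: the value \<open>(0, 1)\<close> forces 7 to divide
      \<open>i\<close> and \<open>j = 0\<close>, and then \<open>a7\<close> makes \<open>X\<close>
      the identity.\<close>
    fix X assume X: "X \<in> carrier ?G" "h X = \<one>\<^bsub>affine21\<^esub>"
    then obtain i j :: nat where j: "j < 3" and Xij: "X = ?a [^]\<^bsub>?G\<^esub> i \<otimes>\<^bsub>?G\<^esub> ?b [^]\<^bsub>?G\<^esub> j"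
      using normal by blast
    then have "int i mod 7 = 0" "(2::int) ^ j = 1"
      using X(2) val[OF j] by (simp_all add: one_affine21)
    then have "j = 0"
      using j by (auto simp: numeral_3_eq_3 less_Suc_eq)
    have "7 dvd i"
      using \<open>int i mod 7 = 0\<close> by presburger
    then obtain k where "i = 7 * k" ..
    then have "?a [^]\<^bsub>?G\<^esub> i = \<one>\<^bsub>?G\<^esub>"
      using a a7 by (simp add: G.nat_pow_pow[symmetric])
    then show "X = \<one>\<^bsub>?G\<^esub>"
      using \<open>j = 0\<close> by (simp add: Xij)
  next
    show "carrier affine21 \<subseteq> h ` carrier ?G"
    proof
      fix p assume "p \<in> carrier affine21"
      then obtain d c where p: "p = (d, c)" "0 \<le> d" "d < 7" "c \<in> {1, 2, 4}"
        by (auto simp: carrier_affine21)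
      obtain j :: nat where j: "j < 3" "c = 2 ^ j"
      proof -
        have "c = 2 ^ 0 \<or> c = 2 ^ 1 \<or> c = 2 ^ 2" using p(4) by auto
        then show thesis using that[of 0] that[of 1] that[of 2] by fastforce
      qed
      have "p = h (?a [^]\<^bsub>?G\<^esub> nat d \<otimes>\<^bsub>?G\<^esub> ?b [^]\<^bsub>?G\<^esub> j)"
        using p j val[OF j(1), of "nat d"] by simp
      then show "p \<in> h ` carrier ?G"
        using a b by blast
    qed
  qed
  with ha hb show ?thesis
    by blast
qed

theorem lemma9:
  fixes R :: "(gen letter list \<times> gen letter list) set"
    and G :: "gen letter list set monoid"
    and a b :: "gen letter list set"
    and S :: "gen letter list set set"
  assumes R_eq: "R = {(replicate 7 (Pos Gen_a), []),
                      (replicate 3 (Pos Gen_b), []),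
                      ([Pos Gen_b, Pos Gen_a, Neg Gen_b], [Pos Gen_a, Pos Gen_a])}"
    and G_eq: "G = presented_group R"
    and a_eq: "a = presented_gen R Gen_a"
    and b_eq: "b = presented_gen R Gen_b"
    and S_eq: "S = boundary G {\<one>\<^bsub>G\<^esub>, a, b}"
  shows "independent_domination_number (cayley_graph G S) = 3 \<and>
         independence_number (cayley_graph G S) = 6"
proof -
  obtain h where h: "h \<in> iso G affine21" and ha: "h a = (1, 1)" and hb: "h b = (0, 2)"
    using presented_group_iso_affine21[OF R_eq] G_eq a_eq b_eq by blast
  have G: "group G"
    by (simp add: G_eq group_presented_group)
  have "h \<one>\<^bsub>G\<^esub> = (0, 1)"
    using hom_one[OF _ G group_affine21, of h] h by (simp add: iso_def one_affine21)
  \<comment> \<open>With this, the graph on the affine side of the isomorphism is exactly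
    \<open>affine_graph\<close>.\<close>
  then have img: "h ` {\<one>\<^bsub>G\<^esub>, a, b} = affine_A"
    by (simp add: ha hb affine_A_def)
  have sub: "{\<one>\<^bsub>G\<^esub>, a, b} \<subseteq> carrier G"
    using group.is_monoid[OF G] by (simp add: G_eq a_eq b_eq presented_gen_closed monoid.one_closed)
  show ?thesis
    using cayley_boundary_numbers_iso[OF G group_affine21 h sub]
      independence_number_affine independent_domination_number_affine
    unfolding img S_eq by simp
qed

end
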